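(* Let $0<q<1$ and $\nu>-1$ be fixed, and let $\{\theta_m^*\}_{m\ge1}$ be a sequence with $0<\theta_m^*<1$ for all $m$ such that $\lim_{m\to\infty}m\theta_m^*=0$. Then, for all sufficiently large $m$, the sign of $\frac{\partial J_{\nu}(z;q^2)}{\partial z}$ remains constant as $z$ ranges over the open interval $\left(q^{-m+\theta_m^{*}},\,q^{-m}\right)$.
   Context: For $0<p<1$: $(a;p)_0=1$, $(a;p)_n=\prod_{i=0}^{n-1}(1-ap^i)$, $(a;p)_\infty=\lim_{n\to\infty}(a;p)_n$. The third Jackson (Hahn--Exton) $q$-Bessel function, with base $q^2$, is defined for $z>0$ by $$J_{\nu}(z;q^2)=z^{\nu}\frac{(q^{2(\nu+1)};q^2)_\infty}{(q^2;q^2)_\infty}\sum_{k=0}^{\infty}(-1)^k\frac{q^{k(k+1)}}{(q^{2(\nu+1)};q^2)_k\,(q^2;q^2)_k}z^{2k}.$$ *)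

theory Defs
  imports "HOL-Analysis.Analysis"
begin

definition qpoch :: "real \<Rightarrow> real \<Rightarrow> nat \<Rightarrow> real" where
  "qpoch a p n = (\<Prod>i<n. 1 - a * p ^ i)"

definition qpoch_inf :: "real \<Rightarrow> real \<Rightarrow> real" where
  "qpoch_inf a p = lim (\<lambda>n. qpoch a p n)"

text \<open>
  The third Jackson (Hahn--Exton) \<open>q\<close>-Bessel function of order \<open>\<nu>\<close> \<^emph>\<open>with base\<close> \<open>q\<^sup>2\<close>, that is
  \<open>hahn_exton q \<nu> z\<close> is \<open>J\<^sub>\<nu>(z; q\<^sup>2)\<close>. It is meaningful for \<open>0 < q < 1\<close> and \<open>z > 0\<close>.
\<close>

definition hahn_exton :: "real \<Rightarrow> real \<Rightarrow> real \<Rightarrow> real" where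
  "hahn_exton q \<nu> z =
     z powr \<nu> * (qpoch_inf (q powr (2 * (\<nu> + 1))) (q\<^sup>2) / qpoch_inf (q\<^sup>2) (q\<^sup>2)) *
     (\<Sum>k. (-1) ^ k * (q ^ (k * (k + 1)) /
            (qpoch (q powr (2 * (\<nu> + 1))) (q\<^sup>2) k * qpoch (q\<^sup>2) (q\<^sup>2) k)) * z ^ (2 * k))"

end

theory Submission imports Defs begin

text \<open>
  Write \<open>p = q\<^sup>2\<close>, \<open>a = p powr (\<nu> + 1)\<close> and \<open>c n = 1 / ((a;p)\<^sub>n (p;p)\<^sub>n)\<close>. Termwise
  differentiation shows that the derivative of \<open>J\<^sub>\<nu>\<close> at \<open>z > 0\<close> is a positive factor times
  \<open>\<Sum>n. (-1)^n d n q^(n(n+1)) z^(2n)\<close> with \<open>d n = (\<nu> + 2n) c n\<close>. The shifted factorials converge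
  geometrically to positive limits, so \<open>d n\<close> is \<open>l n + \<kappa> + o(1)\<close> with \<open>l = 2 lim c > 0\<close>.
  This growth is all that matters about the coefficients.

  For \<open>z\<close> in the \<open>m\<close>-th interval put \<open>z\<^sup>2 = t / q^(2m)\<close>, so that \<open>q powr (2 \<theta> m) < t < 1\<close> and
  \<open>m (1 - t)\<close> is small. As a function of \<open>n = m + j\<close> the exponent of \<open>q\<close> becomes
  \<open>j(j+1) - m(m-1)\<close>, which is symmetric under \<open>j \<mapsto> -1-j\<close>, while the sign \<open>(-1)^j\<close> is
  antisymmetric. Pairing \<open>j = i\<close> with \<open>j = -1-i\<close> (lemma \<open>theta_folding\<close>) cancels everything in \<open>d\<close>
  that is constant in \<open>j\<close>, including the large part \<open>l m\<close>, and leaves the difference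
  \<open>l (2i+1)\<close>. The powers of \<open>t\<close> disturb this cancellation by \<open>O(m (1 - t))\<close>, which is exactly
  where the hypothesis \<open>m \<theta> m \<longlonglongrightarrow> 0\<close> enters. Dominated convergence (Tannery) then gives, after
  multiplication by \<open>(-1)^m q^(m(m-1)) t^(-m)\<close>, the limit \<open>l S\<close> with
  \<open>S = \<Sum>i. (-1)^i (2i+1) q^(i(i+1))\<close> (lemma \<open>theta_limit\<close>). Since \<open>t\<close> may depend on \<open>m\<close> in an
  arbitrary way, the sign is eventually the constant \<open>(-1)^m\<close> on the whole interval
  (lemma \<open>theta_eventually_positive\<close>), provided that \<open>S > 0\<close>.

  Positivity of \<open>S\<close> is Jacobi's identity \<open>S = (p;p)\<^sub>\<infinity>^3\<close> (theorem \<open>jacobi_cube\<close>). It comes from the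
  same limit, applied to Euler's series for \<open>(px;p)\<^sub>\<infinity>\<close>: its derivative at the zero \<open>x = p^(-m)\<close>
  can be computed exactly from the functional equation, and comparing that value with the limit
  determines \<open>S\<close>.
\<close>

section \<open>Finite and infinite shifted factorials\<close>

lemma qpoch_0 [simp]: "qpoch a p 0 = 1"
  by (simp add: qpoch_def)

lemma qpoch_Suc: "qpoch a p (Suc n) = qpoch a p n * (1 - a * p ^ n)"
  by (simp add: qpoch_def)

lemma qpoch_factor:
  fixes a p :: real
  assumes "0 < p" "p < 1" "0 < a" "a < 1"
  shows "0 < 1 - a * p ^ n" "1 - a * p ^ n \<le> 1"
proof -
  have "p ^ n \<le> 1" using assms by (simp add: power_le_one)
  then have "a * p ^ n \<le> a" using assms by (simp add: mult_left_le)
  then show "0 < 1 - a * p ^ n" using assms by linarith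
  show "1 - a * p ^ n \<le> 1" using assms by simp
qed

lemma qpoch_bounds:
  assumes "0 < p" "p < 1" "0 < a" "a < 1"
  shows "0 < qpoch a p n" "qpoch a p n \<le> 1"
proof -
  show "0 < qpoch a p n"
    unfolding qpoch_def by (intro prod_pos) (use qpoch_factor[OF assms] in auto)
  show "qpoch a p n \<le> 1"
    unfolding qpoch_def by (intro prod_le_1) (use qpoch_factor[OF assms] in \<open>auto simp: less_imp_le\<close>)
qed

lemma qpoch_tendsto:
  assumes "0 < p" "p < 1" "0 < a" "a < 1"
  shows "qpoch a p \<longlonglongrightarrow> qpoch_inf a p" "0 < qpoch_inf a p"
proof -
  let ?f = "\<lambda>i. 1 - a * p ^ i"
  have "summable (\<lambda>i. norm (?f i - 1))"
    using assms by (simp add: abs_mult power_abs summable_geometric summable_mult)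
  then have cp: "convergent_prod ?f"
    by (intro abs_convergent_prod_imp_convergent_prod summable_imp_abs_convergent_prod)
  then have "(\<lambda>n. \<Prod>i\<le>n. ?f i) \<longlonglongrightarrow> prodinf ?f"
    by (rule convergent_prod_LIMSEQ)
  then have lim: "qpoch a p \<longlonglongrightarrow> prodinf ?f"
    unfolding qpoch_def using LIMSEQ_lessThan_iff_atMost[of "\<lambda>A. prod ?f A"] by blast
  then have eq: "qpoch_inf a p = prodinf ?f"
    unfolding qpoch_inf_def by (rule limI)
  show "qpoch a p \<longlonglongrightarrow> qpoch_inf a p" using lim eq by simp
  have "prodinf ?f \<noteq> 0"
    using cp qpoch_factor[OF assms] by (intro prodinf_nonzero) (auto simp: less_le)
  moreover have "0 \<le> prodinf ?f"
    using lim by (rule LIMSEQ_le_const) (use qpoch_bounds[OF assms] in \<open>auto simp: less_imp_le\<close>)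
  ultimately show "0 < qpoch_inf a p" using eq by simp
qed

text \<open>
  Consecutive terms differ by at most \<open>p^n\<close>, so the distance to the limit is at most the tail of a
  geometric series. The telescoping form \<open>p^n - p^(n+k)\<close> is what the induction needs.
\<close>

lemma qpoch_diff_bound:
  assumes "0 < p" "p < 1" "0 < a" "a < 1"
  shows "\<bar>qpoch a p n - qpoch_inf a p\<bar> \<le> p ^ n / (1 - p)"
proof -
  have step: "\<bar>qpoch a p n - qpoch a p (n + k)\<bar> \<le> (p ^ n - p ^ (n + k)) / (1 - p)" for k
  proof (induction k)
    case (Suc k)
    have "\<bar>qpoch a p (n + k) - qpoch a p (n + Suc k)\<bar> = qpoch a p (n + k) * a * p ^ (n + k)"
      using qpoch_bounds[OF assms, of "n + k"] assms
      by (simp add: qpoch_Suc algebra_simps)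
    also have "\<dots> \<le> 1 * 1 * p ^ (n + k)"
      using qpoch_bounds[OF assms, of "n + k"] assms
      by (intro mult_mono) auto
    also have "\<dots> = (p ^ (n + k) - p ^ (n + Suc k)) / (1 - p)"
      using assms by (simp add: field_simps)
    finally show ?case using Suc.IH by (simp add: diff_divide_distrib)
  qed simp
  have "(\<lambda>k. \<bar>qpoch a p n - qpoch a p (n + k)\<bar>) \<longlonglongrightarrow> \<bar>qpoch a p n - qpoch_inf a p\<bar>"
    using LIMSEQ_ignore_initial_segment[OF qpoch_tendsto(1)[OF assms], of n]
    by (intro tendsto_intros) (simp add: add.commute)
  moreover have "\<bar>qpoch a p n - qpoch a p (n + k)\<bar> \<le> p ^ n / (1 - p)" for k
    using step[of k] assms by (simp add: divide_simps split: if_splits) 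
      (smt (verit) zero_less_power)
  ultimately show ?thesis by (intro LIMSEQ_le_const2) auto
qed

text \<open>
  A rate faster than \<open>1/n\<close> is what turns a coefficient \<open>n u n\<close> into \<open>n U + o(1)\<close>. The two lemmas
  after this one carry the rate over to products and reciprocals.
\<close>

lemma qpoch_rate:
  assumes "0 < p" "p < 1" "0 < a" "a < 1"
  shows "(\<lambda>n. real n * (qpoch a p n - qpoch_inf a p)) \<longlonglongrightarrow> 0"
proof (rule Lim_null_comparison)
  show "\<forall>\<^sub>F n in sequentially. norm (real n * (qpoch a p n - qpoch_inf a p)) 
          \<le> real n * p ^ n * (1 / (1 - p))"
    using qpoch_diff_bound[OF assms]
    by (intro always_eventually allI)
       (metis abs_mult abs_of_nat mult.assoc mult_left_mono of_nat_0_le_iff real_norm_def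
          times_divide_eq_right mult.right_neutral)
  show "(\<lambda>n. real n * p ^ n * (1 / (1 - p))) \<longlonglongrightarrow> 0"
    using powser_times_n_limit_0[of p] assms by (intro tendsto_mult_left_zero) auto
qed

lemma rate_mult:
  fixes u v :: "nat \<Rightarrow> real"
  assumes u: "(\<lambda>n. real n * (u n - U)) \<longlonglongrightarrow> 0" and v: "(\<lambda>n. real n * (v n - V)) \<longlonglongrightarrow> 0"
    and "v \<longlonglongrightarrow> V"
  shows "(\<lambda>n. real n * (u n * v n - U * V)) \<longlonglongrightarrow> 0"
proof -
  have "(\<lambda>n. real n * (u n - U) * v n + U * (real n * (v n - V))) \<longlonglongrightarrow> 0 * V + U * 0"
    by (intro tendsto_intros assms)
  then show ?thesis by (simp add: algebra_simps)
qed

lemma rate_inverse: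
  fixes u :: "nat \<Rightarrow> real"
  assumes u: "(\<lambda>n. real n * (u n - U)) \<longlonglongrightarrow> 0" and "u \<longlonglongrightarrow> U" "U \<noteq> 0" "\<And>n. u n \<noteq> 0"
  shows "(\<lambda>n. real n * (1 / u n - 1 / U)) \<longlonglongrightarrow> 0"
proof -
  have "(\<lambda>n. - (real n * (u n - U)) / (u n * U)) \<longlonglongrightarrow> - 0 / (U * U)"
    using assms by (intro tendsto_intros) auto
  then show ?thesis using assms by (simp add: field_simps)
qed

section \<open>Theta-type series near their zeros\<close>

text \<open>
  The Gaussian weight \<open>q^(n(n+1))\<close> beats any geometric growth: the \<open>n\<close>-th term is at most the
  \<open>n\<close>-th power of \<open>3 r q^(n+1)\<close>, which tends to \<open>0\<close>. The linear factor absorbs the linear growth of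
  the coefficients in what follows.
\<close>

lemma summable_theta_majorant:
  fixes q r :: real
  assumes "0 < q" "q < 1" "0 \<le> r"
  shows "summable (\<lambda>n. (2 * real n + 1) * q ^ (n * (n + 1)) * r ^ n)"
proof (rule summable_comparison_test_ev)
  have "(\<lambda>n. 3 * r * q ^ Suc n) \<longlonglongrightarrow> 3 * r * 0"
    using assms by (intro tendsto_intros LIMSEQ_Suc LIMSEQ_power_zero) auto
  then have "\<forall>\<^sub>F n in sequentially. 3 * r * q ^ Suc n < 1 / 2"
    by (intro order_tendstoD) auto
  then show "\<forall>\<^sub>F n in sequentially. norm ((2 * real n + 1) * q ^ (n * (n + 1)) * r ^ n) \<le> (1/2) ^ n"
  proof eventually_elim
    case (elim n)
    have "2 * real n + 1 \<le> 3 ^ n"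
      using Bernoulli_inequality[of 2 n] by (simp add: algebra_simps)
    then have "(2 * real n + 1) * q ^ (n * (n + 1)) * r ^ n \<le> 3 ^ n * q ^ (n * (n + 1)) * r ^ n"
      using assms by (intro mult_right_mono) auto
    also have "\<dots> = (3 * r * q ^ Suc n) ^ n"
      by (simp add: power_mult_distrib power_mult[symmetric] mult.commute mult.left_commute flip: power_Suc)
    also have "\<dots> \<le> (1/2) ^ n"
      using elim assms by (intro power_mono) auto
    finally show ?case using assms by simp
  qed
qed simp

lemma linear_growth_bound:
  fixes d :: "nat \<Rightarrow> real"
  assumes "(\<lambda>n. d n - l * real n) \<longlonglongrightarrow> \<kappa>"
  obtains K where "0 < K" "\<And>n. \<bar>d n - l * real n\<bar> \<le> K"
proof -
  have "Bseq (\<lambda>n. d n - l * real n)"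
    using assms by (intro convergent_imp_Bseq convergentI)
  then show ?thesis using that by (auto simp: Bseq_def)
qed

lemma summable_theta:
  fixes q x :: real
  assumes "0 < q" "q < 1" "(\<lambda>n. d n - l * real n) \<longlonglongrightarrow> \<kappa>"
  shows "summable (\<lambda>n. (-1) ^ n * d n * q ^ (n * (n + 1)) * x ^ n)"
proof -
  obtain K where K: "0 < K" "\<And>n. \<bar>d n - l * real n\<bar> \<le> K"
    using linear_growth_bound[OF assms(3)] by blast
  have d: "\<bar>d n\<bar> \<le> (K + \<bar>l\<bar>) * (2 * real n + 1)" for n
  proof -
    have "\<bar>d n\<bar> \<le> K + \<bar>l * real n\<bar>" using K(2)[of n] by linarith
    also have "\<dots> = K * 1 + \<bar>l\<bar> * real n" by (simp add: abs_mult)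
    also have "\<dots> \<le> K * (2 * real n + 1) + \<bar>l\<bar> * (2 * real n + 1)"
      using K(1) by (intro add_mono mult_left_mono) auto
    finally show ?thesis by (simp add: algebra_simps)
  qed
  show ?thesis
  proof (rule summable_comparison_test')
    show "summable (\<lambda>n. (K + \<bar>l\<bar>) * ((2 * real n + 1) * q ^ (n * (n + 1)) * \<bar>x\<bar> ^ n))"
      using assms by (intro summable_mult summable_theta_majorant) auto
    show "norm ((-1) ^ n * d n * q ^ (n * (n + 1)) * x ^ n)
        \<le> (K + \<bar>l\<bar>) * ((2 * real n + 1) * q ^ (n * (n + 1)) * \<bar>x\<bar> ^ n)" for n
    proof -
      have "norm ((-1) ^ n * d n * q ^ (n * (n + 1)) * x ^ n) = \<bar>d n\<bar> * (q ^ (n * (n + 1)) * \<bar>x\<bar> ^ n)"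
        using assms by (simp add: abs_mult power_abs)
      also have "\<dots> \<le> (K + \<bar>l\<bar>) * (2 * real n + 1) * (q ^ (n * (n + 1)) * \<bar>x\<bar> ^ n)"
        using assms d by (intro mult_right_mono) auto
      finally show ?thesis by (simp add: algebra_simps)
    qed
  qed
qed

text \<open>
  The coefficient of \<open>(-1)^i q^(i(i+1))\<close> once the indices \<open>m + i\<close> and \<open>m - 1 - i\<close> have been paired; the
  second index exists only for \<open>i < m\<close>.
\<close>

definition folded_coeff :: "(nat \<Rightarrow> real) \<Rightarrow> real \<Rightarrow> nat \<Rightarrow> nat \<Rightarrow> real" where
  "folded_coeff d t m i =
     d (m + i) * t ^ i - (if i < m then d (m - Suc i) / t ^ Suc i else 0)"

text \<open>
  With \<open>n = m + j\<close> one has \<open>n(n+1) - 2mn + m(m-1) = j(j+1)\<close>, which takes the same value at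
  \<open>j = i\<close> and at \<open>j = -1-i\<close>, whereas \<open>(-1)^j\<close> takes opposite values there.
\<close>

lemma theta_folding:
  fixes q t :: real
  assumes q: "0 < q" "q < 1" and d: "(\<lambda>n. d n - l * real n) \<longlonglongrightarrow> \<kappa>" and t: "0 < t"
  shows "(-1) ^ m * q ^ (m * (m - 1)) / t ^ m *
           (\<Sum>n. (-1) ^ n * d n * q ^ (n * (n + 1)) * (t / q ^ (2 * m)) ^ n)
         = (\<Sum>i. (-1) ^ i * q ^ (i * (i + 1)) * folded_coeff d t m i)"
proof -
  define g where "g n = (-1) ^ n * d n * q ^ (n * (n + 1)) * (t / q ^ (2 * m)) ^ n" for n
  define C where "C = (-1) ^ m * q ^ (m * (m - 1)) / t ^ m"
  define w where "w i = (-1) ^ i * q ^ (i * (i + 1))" for i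
  have sg: "summable g" unfolding g_def by (rule summable_theta[OF q d])
  have upper: "C * g (i + m) = w i * (d (m + i) * t ^ i)" for i
  proof -
    have e: "m * (m - 1) + (i + m) * (i + m + 1) = i * (i + 1) + 2 * m * (i + m)"
      by (cases m) (auto simp: algebra_simps)
    have "q ^ (m * (m - 1)) * q ^ ((i + m) * (i + m + 1)) = q ^ (i * (i + 1)) * q ^ (2 * m * (i + m))"
      by (simp only: power_add[symmetric] e)
    then have 1: "q ^ (m * (m - 1)) * q ^ ((i + m) * (i + m + 1)) / q ^ (2 * m * (i + m)) = q ^ (i * (i + 1))"
      using q by simp
    have 2: "(-1::real) ^ m * (-1) ^ (i + m) = (-1) ^ i"
      by (simp add: power_add mult.left_commute flip: power_mult_distrib)
    have 3: "t ^ (i + m) / t ^ m = t ^ i" using t by (simp add: power_add)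
    have "C * g (i + m) = ((-1) ^ m * (-1) ^ (i + m))
        * (q ^ (m * (m - 1)) * q ^ ((i + m) * (i + m + 1)) / q ^ (2 * m * (i + m)))
        * d (i + m) * (t ^ (i + m) / t ^ m)"
      unfolding C_def g_def power_divide power_mult[symmetric] by (simp add: mult_ac)
    then show ?thesis unfolding 1 2 3 w_def by (simp add: add.commute)
  qed
  have lower: "C * g (m - Suc i) = - (w i * (d (m - Suc i) / t ^ Suc i))" if i: "i < m" for i
  proof -
    obtain k where k: "m = Suc (k + i)"
      using less_imp_Suc_add[OF i] by (auto simp: add.commute)
    have e: "m * (m - 1) + k * (k + 1) = i * (i + 1) + 2 * m * k"
      unfolding k by (auto simp: algebra_simps)
    have "q ^ (m * (m - 1)) * q ^ (k * (k + 1)) = q ^ (i * (i + 1)) * q ^ (2 * m * k)"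
      by (simp only: power_add[symmetric] e)
    then have 1: "q ^ (m * (m - 1)) * q ^ (k * (k + 1)) / q ^ (2 * m * k) = q ^ (i * (i + 1))"
      using q by simp
    have 2: "(-1::real) ^ m * (-1) ^ k = - ((-1) ^ i)"
      by (simp add: k power_add mult.left_commute flip: power_mult_distrib)
    have 3: "t ^ k / t ^ m = 1 / t ^ Suc i" using t by (simp add: k power_add)
    have mk: "m - Suc i = k" using k by simp
    have "C * g k = ((-1) ^ m * (-1) ^ k) * (q ^ (m * (m - 1)) * q ^ (k * (k + 1)) / q ^ (2 * m * k)) * d k * (t ^ k / t ^ m)"
      unfolding C_def g_def power_divide power_mult[symmetric] by (simp add: mult_ac)
    then show ?thesis unfolding mk 1 2 3 w_def by simp
  qed
  have fin: "(\<lambda>i. if i < m then w i * (d (m - Suc i) / t ^ Suc i) else 0) sums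
      (\<Sum>i<m. w i * (d (m - Suc i) / t ^ Suc i))" (is "?h sums _")
    using sums_If_finite_set[of "{..<m}" "\<lambda>i. w i * (d (m - Suc i) / t ^ Suc i)"] by simp
  have sup: "summable (\<lambda>i. w i * (d (m + i) * t ^ i))"
    unfolding upper[symmetric] by (intro summable_mult summable_ignore_initial_segment sg)
  have "C * suminf g = C * ((\<Sum>i. g (i + m)) + (\<Sum>i<m. g i))"
    using suminf_split_initial_segment[OF sg, of m] by simp
  also have "\<dots> = (\<Sum>i. C * g (i + m)) + (\<Sum>i<m. C * g (m - Suc i))"
    using sum.nat_diff_reindex[of "\<lambda>i. C * g i" m] suminf_mult[OF summable_ignore_initial_segment[OF sg, of m], of C]
    by (simp add: distrib_left sum_distrib_left)
  also have "\<dots> = (\<Sum>i. w i * (d (m + i) * t ^ i)) - (\<Sum>i<m. w i * (d (m - Suc i) / t ^ Suc i))"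
    using lower by (simp add: upper sum_negf)
  also have "\<dots> = (\<Sum>i. w i * (d (m + i) * t ^ i) - ?h i)"
    using suminf_diff[OF sup sums_summable[OF fin]] sums_unique[OF fin] by simp
  also have "\<dots> = (\<Sum>i. w i * folded_coeff d t m i)"
    by (intro suminf_cong) (auto simp: folded_coeff_def right_diff_distrib)
  finally show ?thesis unfolding C_def g_def w_def .
qed

lemma one_minus_power_le:
  fixes t :: real
  assumes "0 \<le> t" "t \<le> 1"
  shows "1 - t ^ n \<le> real n * (1 - t)"
  using Bernoulli_inequality[of "t - 1" n] assms by (simp add: algebra_simps)

text \<open>
  This is the error with which the contributions of size \<open>m\<close> fail to cancel between paired indices:
  it is linear in \<open>1 - t\<close>, hence harmless as soon as \<open>m (1 - t)\<close> is small.
\<close>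

lemma folding_defect:
  fixes t :: real
  assumes "0 < t" "t \<le> 1"
  shows "\<bar>t ^ i - 1 / t ^ Suc i\<bar> \<le> (2 * real i + 1) * (1 - t) / t ^ Suc i"
proof -
  have "t ^ i - 1 / t ^ Suc i = - ((1 - t ^ (2 * i + 1)) / t ^ Suc i)"
  proof -
    have "t ^ (2 * i + 1) = t ^ i * t ^ Suc i"
      by (simp add: mult_2 power_add)
    then show ?thesis using assms by (simp add: diff_divide_distrib del: power_Suc)
  qed
  moreover have "0 \<le> 1 - t ^ (2 * i + 1)" using assms by (simp add: power_le_one del: power_Suc)
  ultimately have "\<bar>t ^ i - 1 / t ^ Suc i\<bar> = (1 - t ^ (2 * i + 1)) / t ^ Suc i"
    using assms by simp
  also have "\<dots> \<le> (real (2 * i + 1) * (1 - t)) / t ^ Suc i"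
    using assms by (intro divide_right_mono one_minus_power_le) auto
  finally show ?thesis by (simp add: add.commute)
qed

text \<open>
  Tannery's theorem on the folded series. Writing \<open>d n = e n + l n\<close> with \<open>e\<close> convergent, the folded
  coefficient is a difference of two values of \<open>e\<close>, which cancel in the limit, plus \<open>l\<close> times
  \<open>m\<close> multiplied by the defect estimated in \<open>folding_defect\<close>, plus the surviving part
  \<open>l (i + (i + 1))\<close>. The lower bound \<open>q\<^sup>2 \<le> t m\<close> keeps the negative powers of \<open>t m\<close> below
  \<open>q^(-2(i+1))\<close>, which the weight \<open>q^(i(i+1))\<close> dominates.
\<close>

lemma theta_limit:
  fixes q l :: real and t :: "nat \<Rightarrow> real"
  assumes q: "0 < q" "q < 1" and d: "(\<lambda>n. d n - l * real n) \<longlonglongrightarrow> \<kappa>"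
    and t: "\<And>m. q\<^sup>2 \<le> t m" "\<And>m. t m \<le> 1" and mt: "(\<lambda>m. real m * (1 - t m)) \<longlonglongrightarrow> 0"
  shows "(\<lambda>m. (-1) ^ m * q ^ (m * (m - 1)) / t m ^ m *
             (\<Sum>n. (-1) ^ n * d n * q ^ (n * (n + 1)) * (t m / q ^ (2 * m)) ^ n))
           \<longlonglongrightarrow> l * (\<Sum>i. (-1) ^ i * (2 * real i + 1) * q ^ (i * (i + 1)))"
proof -
  have tpos: "0 < t m" for m using t(1)[of m] q by (smt (verit) zero_less_power)
  define e where "e n = d n - l * real n" for n
  have dn: "d n = e n + l * real n" for n by (simp add: e_def)
  have e: "e \<longlonglongrightarrow> \<kappa>" using d by (simp add: e_def[abs_def])
  obtain K where K: "0 < K" "\<And>n. \<bar>e n\<bar> \<le> K"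
    using linear_growth_bound[OF d] unfolding e_def by blast
  obtain M where M: "0 < M" "\<And>m. \<bar>real m * (1 - t m)\<bar> \<le> M"
    using Bseq_def convergentI[OF mt, THEN convergent_imp_Bseq] by (auto simp: Bseq_def)
  have t1: "t \<longlonglongrightarrow> 1"
  proof -
    have "(\<lambda>m. inverse (real m) * (real m * (1 - t m))) \<longlonglongrightarrow> 0 * 0"
      by (intro tendsto_intros mt lim_inverse_n)
    moreover have "\<forall>\<^sub>F m in sequentially. inverse (real m) * (real m * (1 - t m)) = 1 - t m"
      using eventually_gt_at_top[of 0] by eventually_elim auto
    ultimately have "(\<lambda>m. 1 - t m) \<longlonglongrightarrow> 0" by (simp add: tendsto_cong)
    from tendsto_diff[OF tendsto_const[of 1] this] show ?thesis by simp
  qed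
  have split: "folded_coeff d (t m) m i =
      e (m + i) * t m ^ i - e (m - Suc i) / t m ^ Suc i
      + l * (real m * (t m ^ i - 1 / t m ^ Suc i) + (real i * t m ^ i + (real i + 1) / t m ^ Suc i))"
    if "i < m" for m i
    using that tpos[of m]
    by (simp add: folded_coeff_def dn of_nat_diff field_simps)
  have defect: "\<bar>real m * (t m ^ i - 1 / t m ^ Suc i)\<bar>
      \<le> (2 * real i + 1) * (real m * (1 - t m)) / t m ^ Suc i" for m i
    using mult_left_mono[OF folding_defect[OF tpos t(2)], of "real m" m i] by (simp add: abs_mult mult.left_commute)
  have lim: "(\<lambda>m. folded_coeff d (t m) m i) \<longlonglongrightarrow> l * (2 * real i + 1)" for i
  proof -
    have "(\<lambda>m. (2 * real i + 1) * (real m * (1 - t m)) / t m ^ Suc i) \<longlonglongrightarrow> (2 * real i + 1) * 0 / 1 ^ Suc i"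
      by (intro tendsto_intros mt t1) auto
    then have "(\<lambda>m. (2 * real i + 1) * (real m * (1 - t m)) / t m ^ Suc i) \<longlonglongrightarrow> 0"
      by simp
    then have z: "(\<lambda>m. real m * (t m ^ i - 1 / t m ^ Suc i)) \<longlonglongrightarrow> 0"
      by (rule Lim_null_comparison[OF always_eventually, rotated]) (simp only: real_norm_def defect simp_thms)
    have e1: "(\<lambda>m. e (m + i)) \<longlonglongrightarrow> \<kappa>" by (rule LIMSEQ_ignore_initial_segment[OF e])
    have e2: "(\<lambda>m. e (m - Suc i)) \<longlonglongrightarrow> \<kappa>" by (rule LIMSEQ_offset[of _ "Suc i"]) (simp add: e)
    have "(\<lambda>m. e (m + i) * t m ^ i - e (m - Suc i) / t m ^ Suc i
      + l * (real m * (t m ^ i - 1 / t m ^ Suc i) + (real i * t m ^ i + (real i + 1) / t m ^ Suc i)))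
      \<longlonglongrightarrow> \<kappa> * 1 ^ i - \<kappa> / 1 ^ Suc i + l * (0 + (real i * 1 ^ i + (real i + 1) / 1 ^ Suc i))"
      by (intro tendsto_intros e1 e2 z t1) auto
    also have "\<kappa> * 1 ^ i - \<kappa> / 1 ^ Suc i + l * (0 + (real i * 1 ^ i + (real i + 1) / 1 ^ Suc i)) 
        = l * (2 * real i + 1)"
      by (simp add: algebra_simps)
    finally show ?thesis
      by (rule Lim_transform_eventually)
         (use eventually_gt_at_top[of i] in eventually_elim, simp only: split)
  qed
  define B where "B = 2 * K + \<bar>l\<bar> * (M + 1)"
  define r where "r = 1 / q\<^sup>2"
  have r: "1 \<le> r" using q by (simp add: r_def power_le_one)
  \<comment> \<open>For \<open>i < m\<close> the contributions of size \<open>m\<close> cancel; for \<open>i \<ge> m\<close> there is no partner, but then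
    \<open>m + i \<le> 2 i\<close>, so the same majorant works uniformly in \<open>m\<close>.\<close>
  have bound: "\<bar>folded_coeff d (t m) m i\<bar> \<le> B * (2 * real i + 1) * r ^ Suc i" for m i
  proof -
    have ti: "0 \<le> t m ^ i" "t m ^ i \<le> 1" 
      using tpos[of m] t(2)[of m] by (auto simp: power_le_one less_imp_le)
    have r1: "1 \<le> r ^ Suc i" using r by (rule one_le_power)
    have "1 / t m ^ Suc i = (1 / t m) ^ Suc i" by (simp add: power_divide)
    also have "\<dots> \<le> r ^ Suc i"
      unfolding r_def using tpos[of m] t(1)[of m] q by (intro power_mono) (auto intro: divide_left_mono)
    finally have tr: "1 / t m ^ Suc i \<le> r ^ Suc i" .
    have tr0: "0 \<le> 1 / t m ^ Suc i" using tpos[of m] by simp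
    have e1: "\<bar>e (m + i) * t m ^ i\<bar> \<le> K * r ^ Suc i"
      unfolding abs_mult using K ti r1 by (intro mult_mono) auto
    show ?thesis
    proof (cases "i < m")
      case True
      have e2: "\<bar>e (m - Suc i) / t m ^ Suc i\<bar> \<le> K * r ^ Suc i"
        using mult_mono[OF K(2)[of "m - Suc i"] tr] K(1) tr0 tpos[of m] by (simp add: abs_mult abs_divide)
      have "\<bar>real m * (t m ^ i - 1 / t m ^ Suc i)\<bar> \<le> ((2 * real i + 1) * (real m * (1 - t m))) * (1 / t m ^ Suc i)"
        using defect[of m i] by simp
      also have "\<dots> \<le> ((2 * real i + 1) * M) * r ^ Suc i"
        using M(2)[of m] M(1) tr tr0 t(2)[of m] by (intro mult_mono) auto
      finally have a1: "\<bar>real m * (t m ^ i - 1 / t m ^ Suc i)\<bar> \<le> (2 * real i + 1) * M * r ^ Suc i" .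
      have "\<bar>real i * t m ^ i + (real i + 1) / t m ^ Suc i\<bar> 
          = real i * t m ^ i + (real i + 1) * (1 / t m ^ Suc i)"
        using ti tr0 tpos[of m] by simp
      also have "\<dots> \<le> real i * r ^ Suc i + (real i + 1) * r ^ Suc i"
        using ti tr r1 by (intro add_mono mult_left_mono) auto
      finally have a2: "\<bar>real i * t m ^ i + (real i + 1) / t m ^ Suc i\<bar> \<le> (2 * real i + 1) * r ^ Suc i"
        by (simp add: algebra_simps)
      have "\<bar>l * (real m * (t m ^ i - 1 / t m ^ Suc i) + (real i * t m ^ i + (real i + 1) / t m ^ Suc i))\<bar>
          \<le> \<bar>l\<bar> * ((2 * real i + 1) * M * r ^ Suc i + (2 * real i + 1) * r ^ Suc i)"
        unfolding abs_mult[of l] using a1 a2 by (intro mult_left_mono) linarith+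
      then have "\<bar>folded_coeff d (t m) m i\<bar> \<le> 2 * K * r ^ Suc i + 
          \<bar>l\<bar> * ((2 * real i + 1) * M * r ^ Suc i + (2 * real i + 1) * r ^ Suc i)"
        using e1 e2 unfolding split[OF True] by linarith
      also have "2 * K * r ^ Suc i \<le> 2 * K * (2 * real i + 1) * r ^ Suc i"
        using K r1 by (intro mult_right_mono) auto
      finally show ?thesis by (simp add: B_def algebra_simps)
    next
      case False
      have "\<bar>l * real (m + i) * t m ^ i\<bar> \<le> \<bar>l\<bar> * (2 * real i + 1) * r ^ Suc i"
        unfolding abs_mult using False ti r1 by (intro mult_mono) auto
      moreover have "folded_coeff d (t m) m i = e (m + i) * t m ^ i + l * real (m + i) * t m ^ i"
        using False by (simp add: folded_coeff_def dn algebra_simps)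
      ultimately have "\<bar>folded_coeff d (t m) m i\<bar> \<le> K * r ^ Suc i + \<bar>l\<bar> * (2 * real i + 1) * r ^ Suc i"
        using e1 by linarith
      also have "\<dots> \<le> (2 * K * (2 * real i + 1)) * r ^ Suc i + \<bar>l\<bar> * (M + 1) * (2 * real i + 1) * r ^ Suc i"
        using K M r1 by (intro add_mono mult_right_mono mult_left_mono) (auto simp: algebra_simps mult_left_mono)
      finally show ?thesis by (simp add: B_def algebra_simps)
    qed
  qed
  have T: "(\<lambda>m. \<Sum>i. (-1) ^ i * q ^ (i * (i + 1)) * folded_coeff d (t m) m i)
      \<longlonglongrightarrow> (\<Sum>i. (-1) ^ i * q ^ (i * (i + 1)) * (l * (2 * real i + 1)))"
  proof (rule tannerys_theorem[THEN conjunct2, THEN conjunct2])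
    show "((\<lambda>m. (-1) ^ k * q ^ (k * (k + 1)) * folded_coeff d (t m) m k)
          \<longlongrightarrow> (-1) ^ k * q ^ (k * (k + 1)) * (l * (2 * real k + 1))) sequentially" for k
      by (intro tendsto_intros lim)
    show "\<forall>\<^sub>F (k, m) in sequentially \<times>\<^sub>F sequentially.
         norm ((-1) ^ k * q ^ (k * (k + 1)) * folded_coeff d (t m) m k)
         \<le> B * r * ((2 * real k + 1) * q ^ (k * (k + 1)) * r ^ k)"
    proof (intro always_eventually allI, clarify)
      fix k m
      have "norm ((-1) ^ k * q ^ (k * (k + 1)) * folded_coeff d (t m) m k)
          = q ^ (k * (k + 1)) * \<bar>folded_coeff d (t m) m k\<bar>"
        using q by (simp add: abs_mult power_abs)
      also have "\<dots> \<le> q ^ (k * (k + 1)) * (B * (2 * real k + 1) * r ^ Suc k)"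
        using q bound by (intro mult_left_mono) auto
      finally show "norm ((-1) ^ k * q ^ (k * (k + 1)) * folded_coeff d (t m) m k)
         \<le> B * r * ((2 * real k + 1) * q ^ (k * (k + 1)) * r ^ k)"
        by (simp add: algebra_simps)
    qed
    show "summable (\<lambda>k. B * r * ((2 * real k + 1) * q ^ (k * (k + 1)) * r ^ k))"
      using q r by (intro summable_mult summable_theta_majorant) auto
  qed simp
  have "summable (\<lambda>i. (-1) ^ i * (2 * real i + 1) * q ^ (i * (i + 1)) * 1 ^ i)"
    by (rule summable_theta[OF q, of _ 2 1]) simp
  then have "(\<Sum>i. (-1) ^ i * q ^ (i * (i + 1)) * (l * (2 * real i + 1)))
      = l * (\<Sum>i. (-1) ^ i * (2 * real i + 1) * q ^ (i * (i + 1)))"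
    by (subst suminf_mult[symmetric]) (auto simp: algebra_simps)
  with T show ?thesis by (simp only: theta_folding[OF q d tpos])
qed


text \<open>
  Uniformity in \<open>t\<close> is obtained from the limit along sequences: if some \<open>t\<close> in \<open>{\<tau> m..1}\<close> violates
  the claim, let \<open>T m\<close> be such a \<open>t\<close>. The limit theorem applies to \<open>T\<close> and shows that from
  some \<open>m\<close> on there is no violation.
\<close>

lemma theta_eventually_positive:
  fixes q l :: real and \<tau> :: "nat \<Rightarrow> real"
  assumes q: "0 < q" "q < 1" and d: "(\<lambda>n. d n - l * real n) \<longlonglongrightarrow> \<kappa>"
    and \<tau>: "\<And>m. q\<^sup>2 \<le> \<tau> m" "\<And>m. \<tau> m \<le> 1" and m\<tau>: "(\<lambda>m. real m * (1 - \<tau> m)) \<longlonglongrightarrow> 0"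
    and pos: "0 < l * (\<Sum>i. (-1) ^ i * (2 * real i + 1) * q ^ (i * (i + 1)))"
  shows "\<forall>\<^sub>F m in sequentially. \<forall>t\<in>{\<tau> m..1}.
           0 < (-1) ^ m * (\<Sum>n. (-1) ^ n * d n * q ^ (n * (n + 1)) * (t / q ^ (2 * m)) ^ n)"
proof -
  define G where "G m t = (\<Sum>n. (-1) ^ n * d n * q ^ (n * (n + 1)) * (t / q ^ (2 * m)) ^ n)" for m t
  define bad where "bad m t \<longleftrightarrow> t \<in> {\<tau> m..1} \<and> \<not> 0 < (-1) ^ m * G m t" for m t
  define T where "T m = (if \<exists>t. bad m t then SOME t. bad m t else 1)" for m
  have badT: "bad m (T m)" if "bad m t" for m t
    unfolding T_def using that by (auto intro: someI)
  have "\<tau> m \<le> T m \<and> T m \<le> 1" for m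
  proof (cases "\<exists>t. bad m t")
    case True
    then have "bad m (T m)" using badT by blast
    then show ?thesis by (simp add: bad_def)
  next
    case False
    then show ?thesis using \<tau>(2)[of m] by (simp add: T_def)
  qed
  then have T: "\<tau> m \<le> T m" "T m \<le> 1" for m by auto
  have Tq: "q\<^sup>2 \<le> T m" for m by (rule order_trans[OF \<tau>(1) T(1)])
  have "(\<lambda>m. real m * (1 - T m)) \<longlonglongrightarrow> 0"
  proof (rule tendsto_sandwich[OF _ _ tendsto_const m\<tau>])
    show "\<forall>\<^sub>F m in sequentially. 0 \<le> real m * (1 - T m)" using T(2) by simp
    show "\<forall>\<^sub>F m in sequentially. real m * (1 - T m) \<le> real m * (1 - \<tau> m)"
      using T(1) by (simp add: mult_left_mono)
  qed
  from order_tendstoD(1)[OF theta_limit[OF q d Tq T(2) this] pos]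
  have "\<forall>\<^sub>F m in sequentially. 0 < (-1) ^ m * q ^ (m * (m - 1)) / T m ^ m * G m (T m)"
    by (simp only: G_def)
  then show ?thesis
  proof eventually_elim
    case (elim m)
    have "0 < T m" using Tq[of m] q by (smt (verit) zero_less_power)
    then have "0 < q ^ (m * (m - 1)) / T m ^ m" using q by simp
    moreover have "0 < q ^ (m * (m - 1)) / T m ^ m * ((-1) ^ m * G m (T m))"
      using elim by (simp add: mult_ac)
    ultimately have "0 < (-1) ^ m * G m (T m)" by (rule zero_less_mult_pos[rotated])
    then have "\<not> bad m t" for t using badT[of m t] by (auto simp: bad_def)
    then show ?case by (auto simp: bad_def G_def)
  qed
qed

section \<open>Jacobi's identity for the cube of the Euler product\<close>

text \<open>
  The series \<open>euler_series q x\<close> is Euler's expansion of \<open>\<Prod>k\<ge>1. 1 - q^(2k) x\<close>, and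
  \<open>euler_series_deriv q x\<close> is \<open>x\<close> times its derivative in \<open>x\<close>. Both are treated as power series:
  the functional equations below stand in for the product.
\<close>

definition euler_coeff :: "real \<Rightarrow> nat \<Rightarrow> real" where
  "euler_coeff q n = (-1) ^ n * (1 / qpoch (q\<^sup>2) (q\<^sup>2) n) * q ^ (n * (n + 1))"

definition euler_series :: "real \<Rightarrow> real \<Rightarrow> real" where
  "euler_series q x = (\<Sum>n. euler_coeff q n * x ^ n)"

definition euler_series_deriv :: "real \<Rightarrow> real \<Rightarrow> real" where
  "euler_series_deriv q x = (\<Sum>n. real n * euler_coeff q n * x ^ n)"

context
  fixes q :: real
  assumes q: "0 < q" "q < 1"
begin

lemma base_bounds: "0 < q\<^sup>2" "q\<^sup>2 < 1"
  using q by (auto simp: power_less_one_iff)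

lemma qpoch_q_pos: "0 < qpoch (q\<^sup>2) (q\<^sup>2) n"
  using qpoch_bounds[OF base_bounds base_bounds] by simp

lemma inverse_qpoch_tendsto:
  "(\<lambda>n. 1 / qpoch (q\<^sup>2) (q\<^sup>2) n) \<longlonglongrightarrow> 1 / qpoch_inf (q\<^sup>2) (q\<^sup>2)"
  using qpoch_tendsto[OF base_bounds base_bounds] by (intro tendsto_intros) auto

lemma inverse_qpoch_rate:
  "(\<lambda>n. real n * (1 / qpoch (q\<^sup>2) (q\<^sup>2) n - 1 / qpoch_inf (q\<^sup>2) (q\<^sup>2))) \<longlonglongrightarrow> 0"
  using qpoch_tendsto[OF base_bounds base_bounds] qpoch_q_pos
  by (intro rate_inverse qpoch_rate base_bounds) (auto simp: less_le)

lemma linear_growth_euler: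
  "(\<lambda>n. real n * (1 / qpoch (q\<^sup>2) (q\<^sup>2) n) - 1 / qpoch_inf (q\<^sup>2) (q\<^sup>2) * real n) \<longlonglongrightarrow> 0"
  using inverse_qpoch_rate by (simp add: right_diff_distrib mult.commute)

lemma summable_euler: "summable (\<lambda>n. euler_coeff q n * x ^ n)"
  unfolding euler_coeff_def
  by (rule summable_theta[OF q, where l = 0]) (use inverse_qpoch_tendsto in simp)

lemma summable_euler_deriv: "summable (\<lambda>n. real n * euler_coeff q n * x ^ n)"
  using summable_theta[OF q linear_growth_euler, of x]
  by (simp add: euler_coeff_def mult_ac)

text \<open>
  This is the functional equation \<open>E(x) = (1 - q\<^sup>2 x) E(q\<^sup>2 x)\<close> read off coefficientwise.
\<close>

lemma euler_coeff_Suc: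
  "euler_coeff q (Suc n) = (q\<^sup>2) ^ Suc n * euler_coeff q (Suc n) - (q\<^sup>2) ^ Suc n * euler_coeff q n"
proof -
  have nz: "1 - (q\<^sup>2) ^ Suc n \<noteq> 0"
    using qpoch_factor(1)[OF base_bounds base_bounds, of n] by simp
  have "q ^ (Suc n * (Suc n + 1)) = q ^ (n * (n + 1)) * (q\<^sup>2) ^ Suc n"
    unfolding power_mult[symmetric] power_add[symmetric]
    by (rule arg_cong[where f = "power q"]) simp
  then have "euler_coeff q (Suc n) = - (euler_coeff q n * (q\<^sup>2) ^ Suc n / (1 - (q\<^sup>2) ^ Suc n))"
    by (simp only: euler_coeff_def qpoch_Suc) simp
  then have "euler_coeff q (Suc n) * (1 - (q\<^sup>2) ^ Suc n) = - (euler_coeff q n * (q\<^sup>2) ^ Suc n)"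
    using nz by (simp del: power_Suc)
  then show ?thesis by (simp add: algebra_simps)
qed

lemma euler_series_eq:
  "euler_series q x = (1 - q\<^sup>2 * x) * euler_series q (q\<^sup>2 * x)"
proof -
  let ?p = "q\<^sup>2"
  have E: "(\<lambda>n. euler_coeff q n * (?p * x) ^ n) sums euler_series q (?p * x)"
    unfolding euler_series_def by (rule summable_sums[OF summable_euler])
  define sh where "sh n = (case n of 0 \<Rightarrow> 0 | Suc k \<Rightarrow> ?p * x * (euler_coeff q k * (?p * x) ^ k))" for n
  have "sh sums (?p * x * euler_series q (?p * x))"
    by (rule sums_Suc_imp) (auto simp: sh_def intro!: sums_mult E)
  from sums_diff[OF E this]
  have "(\<lambda>n. euler_coeff q n * (?p * x) ^ n - sh n) sums ((1 - ?p * x) * euler_series q (?p * x))"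
    by (simp add: left_diff_distrib)
  moreover have "euler_coeff q n * (?p * x) ^ n - sh n = euler_coeff q n * x ^ n" for n
  proof (cases n)
    case (Suc k)
    have "euler_coeff q n * (?p * x) ^ n - sh n
        = (?p ^ Suc k * euler_coeff q (Suc k) - ?p ^ Suc k * euler_coeff q k) * x ^ Suc k"
      by (simp add: Suc sh_def power_mult_distrib algebra_simps)
    then show ?thesis using euler_coeff_Suc[of k] by (simp only: Suc)
  qed (simp add: sh_def)
  ultimately show ?thesis unfolding euler_series_def by (simp add: sums_iff)
qed

text \<open>
  The operator \<open>x d/dx\<close> applied to the functional equation of \<open>euler_series\<close>; since this operator
  commutes with \<open>x \<mapsto> q\<^sup>2 x\<close>, it again follows by comparing coefficients.
\<close>

lemma euler_series_deriv_eq: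
  "euler_series_deriv q x = (1 - q\<^sup>2 * x) * euler_series_deriv q (q\<^sup>2 * x)
     - q\<^sup>2 * x * euler_series q (q\<^sup>2 * x)"
proof -
  let ?p = "q\<^sup>2"
  have E: "(\<lambda>n. euler_coeff q n * (?p * x) ^ n) sums euler_series q (?p * x)"
    unfolding euler_series_def by (rule summable_sums[OF summable_euler])
  have D: "(\<lambda>n. real n * euler_coeff q n * (?p * x) ^ n) sums euler_series_deriv q (?p * x)"
    unfolding euler_series_deriv_def by (rule summable_sums[OF summable_euler_deriv])
  define sh where "sh n = (case n of 0 \<Rightarrow> 0 | Suc k \<Rightarrow>
      ?p * x * (real k * euler_coeff q k * (?p * x) ^ k + euler_coeff q k * (?p * x) ^ k))" for n
  have "sh sums (?p * x * (euler_series_deriv q (?p * x) + euler_series q (?p * x)))"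
    by (rule sums_Suc_imp) (auto simp: sh_def intro!: sums_mult sums_add E D)
  from sums_diff[OF D this]
  have "(\<lambda>n. real n * euler_coeff q n * (?p * x) ^ n - sh n) sums
      ((1 - ?p * x) * euler_series_deriv q (?p * x) - ?p * x * euler_series q (?p * x))"
    by (simp add: algebra_simps)
  moreover have "real n * euler_coeff q n * (?p * x) ^ n - sh n = real n * euler_coeff q n * x ^ n" for n
  proof (cases n)
    case (Suc k)
    have "real n * euler_coeff q n * (?p * x) ^ n - sh n
        = real n * (?p ^ Suc k * euler_coeff q (Suc k) - ?p ^ Suc k * euler_coeff q k) * x ^ Suc k"
      by (simp add: Suc sh_def power_mult_distrib algebra_simps)
    then show ?thesis using euler_coeff_Suc[of k] by (simp only: Suc)
  qed (simp add: sh_def)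
  ultimately show ?thesis unfolding euler_series_deriv_def by (simp add: sums_iff)
qed

text \<open>
  Iterating the functional equation from \<open>x = 1\<close> moves the argument to \<open>q^(2n)\<close>, which tends to
  \<open>0\<close>, and produces the finite product \<open>qpoch (q\<^sup>2) (q\<^sup>2) n\<close>.
\<close>

lemma euler_series_one: "euler_series q 1 = qpoch_inf (q\<^sup>2) (q\<^sup>2)"
proof -
  let ?p = "q\<^sup>2"
  have fin: "euler_series q 1 = qpoch ?p ?p n * euler_series q (?p ^ n)" for n
  proof (induction n)
    case (Suc n)
    then show ?case using euler_series_eq[of "?p ^ n"] by (simp add: qpoch_Suc)
  qed simp
  have "isCont (euler_series q) 0"
    unfolding euler_series_def[abs_def]
    by (rule isCont_powser_converges_everywhere) (rule summable_euler)
  moreover have "(\<lambda>n. ?p ^ n) \<longlonglongrightarrow> 0"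
    using base_bounds by (intro LIMSEQ_power_zero) auto
  ultimately have "(\<lambda>n. euler_series q (?p ^ n)) \<longlonglongrightarrow> euler_series q 0"
    by (rule isCont_tendsto_compose)
  moreover have "euler_series q 0 = 1"
    unfolding euler_series_def powser_zero by (simp add: euler_coeff_def)
  ultimately have "(\<lambda>n. qpoch ?p ?p n * euler_series q (?p ^ n)) \<longlonglongrightarrow> qpoch_inf ?p ?p * 1"
    using qpoch_tendsto(1)[OF base_bounds base_bounds] by (intro tendsto_mult) simp_all
  then show ?thesis unfolding fin[symmetric] by (simp add: LIMSEQ_const_iff)
qed

lemma base_shift: "q\<^sup>2 * (1 / (q\<^sup>2) ^ Suc k) = 1 / (q\<^sup>2) ^ k"
  using q by simp

lemma euler_series_zero: "euler_series q (1 / (q\<^sup>2) ^ Suc m) = 0"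
proof (induction m)
  case 0
  then show ?case using euler_series_eq[of "1 / q\<^sup>2"] q by simp
next
  case (Suc m)
  then show ?case using euler_series_eq[of "1 / (q\<^sup>2) ^ Suc (Suc m)"]
    by (simp only: base_shift mult_zero_right)
qed

text \<open>
  At a zero of the series the inhomogeneous term of the functional equation for the derivative
  vanishes, so passing from one zero to the next only multiplies by \<open>1 - q^(-2(m+1))\<close>. The
  normalising power of \<open>q\<close> is the one of \<open>theta_limit\<close>, with \<open>m + 1\<close> in place of \<open>m\<close>.
\<close>

lemma euler_series_deriv_at_zero:
  "(-1) ^ Suc m * q ^ (Suc m * m) * euler_series_deriv q (1 / (q\<^sup>2) ^ Suc m)
     = euler_series q 1 * qpoch (q\<^sup>2) (q\<^sup>2) m"
proof (induction m)
  case 0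
  then show ?case using euler_series_deriv_eq[of "1 / q\<^sup>2"] q by simp
next
  case (Suc m)
  let ?p = "q\<^sup>2"
  have D: "euler_series_deriv q (1 / ?p ^ Suc (Suc m))
      = (1 - 1 / ?p ^ Suc m) * euler_series_deriv q (1 / ?p ^ Suc m)"
    using euler_series_deriv_eq[of "1 / ?p ^ Suc (Suc m)"] euler_series_zero[of m] unfolding base_shift by simp
  have w: "q ^ (Suc (Suc m) * Suc m) = q ^ (Suc m * m) * ?p ^ Suc m"
    unfolding power_mult[symmetric] power_add[symmetric]
    by (rule arg_cong[where f = "power q"]) simp
  have c: "?p ^ Suc m * (1 - 1 / ?p ^ Suc m) = - (1 - ?p * ?p ^ m)"
    using q by (simp add: field_simps)
  have "(-1) ^ Suc (Suc m) * q ^ (Suc (Suc m) * Suc m) * euler_series_deriv q (1 / ?p ^ Suc (Suc m))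
      = - ((-1) ^ Suc m * q ^ (Suc m * m) * euler_series_deriv q (1 / ?p ^ Suc m))
          * (?p ^ Suc m * (1 - 1 / ?p ^ Suc m))"
    unfolding D w by (simp add: mult_ac)
  also have "\<dots> = euler_series q 1 * qpoch ?p ?p (Suc m)"
    unfolding Suc c by (simp add: qpoch_Suc algebra_simps)
  finally show ?case .
qed

text \<open>
  Taking \<open>d n = n / (q\<^sup>2;q\<^sup>2)\<^sub>n\<close> and \<open>t = 1\<close> in \<open>theta_limit\<close> produces \<open>S / P\<close>, where \<open>P\<close> is the
  infinite product, whereas the exact values of the derivative at the zeros tend to \<open>P * P\<close>.
\<close>

theorem jacobi_cube:
  "(\<Sum>i. (-1) ^ i * (2 * real i + 1) * q ^ (i * (i + 1))) = qpoch_inf (q\<^sup>2) (q\<^sup>2) ^ 3"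
  (is "?S = ?P ^ 3")
proof -
  have P: "0 < ?P" by (rule qpoch_tendsto(2)[OF base_bounds base_bounds])
  have D: "(\<Sum>n. (-1) ^ n * (real n * (1 / qpoch (q\<^sup>2) (q\<^sup>2) n)) * q ^ (n * (n + 1)) * (1 / q ^ (2 * m)) ^ n)
      = euler_series_deriv q (1 / (q\<^sup>2) ^ m)" for m
    unfolding euler_series_deriv_def euler_coeff_def power_mult by (simp add: mult_ac)
  have q1: "q\<^sup>2 \<le> 1" using base_bounds by simp
  have "(\<lambda>m. (-1) ^ m * q ^ (m * (m - 1)) * euler_series_deriv q (1 / (q\<^sup>2) ^ m)) \<longlonglongrightarrow> 1 / ?P * ?S"
    using theta_limit[OF q linear_growth_euler, of "\<lambda>_. 1"] q1 unfolding D by simp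
  then have "(\<lambda>m. (-1) ^ Suc m * q ^ (Suc m * (Suc m - 1)) * euler_series_deriv q (1 / (q\<^sup>2) ^ Suc m))
      \<longlonglongrightarrow> 1 / ?P * ?S"
    by (rule LIMSEQ_Suc)
  then have "(\<lambda>m. ?P * qpoch (q\<^sup>2) (q\<^sup>2) m) \<longlonglongrightarrow> 1 / ?P * ?S"
    unfolding diff_Suc_1 euler_series_deriv_at_zero euler_series_one .
  moreover have "(\<lambda>m. ?P * qpoch (q\<^sup>2) (q\<^sup>2) m) \<longlonglongrightarrow> ?P * ?P"
    by (intro tendsto_intros qpoch_tendsto base_bounds)
  ultimately have "1 / ?P * ?S = ?P * ?P" by (rule LIMSEQ_unique)
  then show ?thesis using P by (simp add: field_simps power3_eq_cube)
qed

end

section \<open>The derivative of the Hahn--Exton function\<close>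

text \<open>
  On monomials, \<open>z d/dz\<close> maps \<open>z powr \<nu> * z^(2n)\<close> to \<open>\<nu> + 2n\<close> times itself. Convergence
  of \<open>c\<close> makes the power series in \<open>z\<^sup>2\<close> converge everywhere, which justifies termwise
  differentiation.
\<close>

lemma DERIV_hahn_exton:
  fixes q \<nu> z :: real
  assumes q: "0 < q" "q < 1" and z: "0 < z"
  defines "c \<equiv> \<lambda>n. 1 / (qpoch (q powr (2 * (\<nu> + 1))) (q\<^sup>2) n * qpoch (q\<^sup>2) (q\<^sup>2) n)"
  assumes c: "c \<longlonglongrightarrow> L"
  shows "(hahn_exton q \<nu> has_real_derivative
            z powr (\<nu> - 1) * (qpoch_inf (q powr (2 * (\<nu> + 1))) (q\<^sup>2) / qpoch_inf (q\<^sup>2) (q\<^sup>2)) *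
            (\<Sum>n. (-1) ^ n * ((\<nu> + 2 * real n) * c n) * q ^ (n * (n + 1)) * (z\<^sup>2) ^ n)) (at z)"
proof -
  define C where "C = qpoch_inf (q powr (2 * (\<nu> + 1))) (q\<^sup>2) / qpoch_inf (q\<^sup>2) (q\<^sup>2)"
  define f where "f n = (-1) ^ n * c n * q ^ (n * (n + 1))" for n
  define F where "F x = (\<Sum>n. f n * x ^ n)" for x
  have sf: "summable (\<lambda>n. f n * x ^ n)" for x
    unfolding f_def by (rule summable_theta[OF q, where l = 0]) (use c in simp)
  have dF: "(F has_real_derivative (\<Sum>n. diffs f n * x ^ n)) (at x)" for x
    unfolding F_def[abs_def] by (rule termdiffs_strong_converges_everywhere) (rule sf)
  have sd: "summable (\<lambda>n. diffs f n * x ^ n)" for x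
    by (rule termdiff_converges_all) (rule sf)
  have xd: "(\<lambda>n. real n * f n * x ^ n) sums (x * (\<Sum>n. diffs f n * x ^ n))" for x
  proof (rule sums_Suc_imp)
    have "(\<lambda>n. x * (diffs f n * x ^ n)) sums (x * (\<Sum>n. diffs f n * x ^ n))"
      by (intro sums_mult summable_sums sd)
    then show "(\<lambda>n. real (Suc n) * f (Suc n) * x ^ Suc n) sums (x * (\<Sum>n. diffs f n * x ^ n))"
      by (simp add: diffs_def mult_ac)
  qed simp
  have "(\<lambda>n. \<nu> * (f n * (z\<^sup>2) ^ n) + 2 * (real n * f n * (z\<^sup>2) ^ n)) sums
      (\<nu> * F (z\<^sup>2) + 2 * (z\<^sup>2 * (\<Sum>n. diffs f n * (z\<^sup>2) ^ n)))"
    unfolding F_def by (intro sums_add sums_mult xd summable_sums sf)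
  then have G: "(\<Sum>n. (-1) ^ n * ((\<nu> + 2 * real n) * c n) * q ^ (n * (n + 1)) * (z\<^sup>2) ^ n)
      = \<nu> * F (z\<^sup>2) + 2 * (z\<^sup>2 * (\<Sum>n. diffs f n * (z\<^sup>2) ^ n))"
    by (simp add: sums_iff f_def algebra_simps)
  have "((\<lambda>z. F (z\<^sup>2)) has_real_derivative (\<Sum>n. diffs f n * (z\<^sup>2) ^ n) * (2 * z)) (at z)"
    by (rule DERIV_chain2[OF dF]) (auto intro!: derivative_eq_intros)
  then have "((\<lambda>z. z powr \<nu> * C * F (z\<^sup>2)) has_real_derivative
      \<nu> * z powr (\<nu> - 1) * C * F (z\<^sup>2) + z powr \<nu> * C * ((\<Sum>n. diffs f n * (z\<^sup>2) ^ n) * (2 * z))) (at z)"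
    using z by (auto intro!: derivative_eq_intros)
  moreover have "\<nu> * z powr (\<nu> - 1) * C * F (z\<^sup>2) + z powr \<nu> * C * ((\<Sum>n. diffs f n * (z\<^sup>2) ^ n) * (2 * z))
      = z powr (\<nu> - 1) * C * (\<nu> * F (z\<^sup>2) + 2 * (z\<^sup>2 * (\<Sum>n. diffs f n * (z\<^sup>2) ^ n)))"
    using z by (simp add: powr_diff field_simps power2_eq_square)
  moreover have "hahn_exton q \<nu> = (\<lambda>z. z powr \<nu> * C * F (z\<^sup>2))"
    by (simp add: fun_eq_iff hahn_exton_def C_def F_def f_def c_def power_mult)
  ultimately show ?thesis unfolding C_def[symmetric] G by simp
qed

theorem corollary3p3:
  fixes q \<nu> :: real and \<theta> :: "nat \<Rightarrow> real"
  assumes "0 < q" and "q < 1" and "\<nu> > -1"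
    and "\<And>m. m \<ge> 1 \<Longrightarrow> 0 < \<theta> m \<and> \<theta> m < 1"
    and "(\<lambda>m. real m * \<theta> m) \<longlonglongrightarrow> 0"
  shows "\<forall>\<^sub>F m in sequentially.
           \<exists>s::real. s \<noteq> 0 \<and>
             (\<forall>z \<in> {q powr (- real m + \<theta> m) <..< q powr (- real m)}.
                sgn (deriv (hahn_exton q \<nu>) z) = s)"
proof -
  note q = assms(1,2) and \<theta> = assms(4)
  note q2 = base_bounds[OF q]
  define a where "a = q powr (2 * (\<nu> + 1))"
  have a: "0 < a" "a < 1"
    unfolding a_def using q assms(3) powr_less_mono'[of q 0 "2 * (\<nu> + 1)"] by (simp_all del: powr_less_cancel_iff)
  define A where "A = qpoch_inf a (q\<^sup>2)"
  define P where "P = qpoch_inf (q\<^sup>2) (q\<^sup>2)"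
  have AP: "0 < A" "0 < P"
    unfolding A_def P_def by (rule qpoch_tendsto(2)[OF q2 a], rule qpoch_tendsto(2)[OF q2 q2])
  define c where "c n = 1 / (qpoch a (q\<^sup>2) n * qpoch (q\<^sup>2) (q\<^sup>2) n)" for n
  define L where "L = 1 / (A * P)"
  have uv: "(\<lambda>n. qpoch a (q\<^sup>2) n * qpoch (q\<^sup>2) (q\<^sup>2) n) \<longlonglongrightarrow> A * P"
    unfolding A_def P_def by (intro tendsto_mult qpoch_tendsto q2 a)
  have c: "c \<longlonglongrightarrow> L"
    unfolding c_def[abs_def] L_def by (rule tendsto_divide[OF tendsto_const uv]) (use AP in simp)
  have nc: "(\<lambda>n. real n * (c n - L)) \<longlonglongrightarrow> 0"
    unfolding c_def L_def
  proof (rule rate_inverse[OF _ uv])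
    show "(\<lambda>n. real n * (qpoch a (q\<^sup>2) n * qpoch (q\<^sup>2) (q\<^sup>2) n - A * P)) \<longlonglongrightarrow> 0"
      unfolding A_def P_def by (intro rate_mult qpoch_rate qpoch_tendsto q2 a)
    show "qpoch a (q\<^sup>2) n * qpoch (q\<^sup>2) (q\<^sup>2) n \<noteq> 0" for n
      using qpoch_bounds(1)[OF q2 a, of n] qpoch_bounds(1)[OF q2 q2, of n] by simp
  qed (use AP in simp)
  define d where "d n = (\<nu> + 2 * real n) * c n" for n
  have "(\<lambda>n. \<nu> * c n + 2 * (real n * (c n - L))) \<longlonglongrightarrow> \<nu> * L + 2 * 0"
    by (intro tendsto_intros c nc)
  then have d: "(\<lambda>n. d n - 2 * L * real n) \<longlonglongrightarrow> \<nu> * L"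
    by (simp add: d_def algebra_simps)
  have pos: "0 < 2 * L * (\<Sum>i. (-1) ^ i * (2 * real i + 1) * q ^ (i * (i + 1)))"
    unfolding jacobi_cube[OF q] using AP by (simp add: L_def P_def)
  \<comment> \<open>In terms of \<open>t = z\<^sup>2 q^(2m)\<close> the interval lies in \<open>{\<tau> m..1}\<close>. The value \<open>1\<close> at \<open>m = 0\<close>, where
    nothing is known about \<open>\<theta>\<close>, makes the bounds on \<open>\<tau>\<close> hold for every index.\<close>
  define \<tau> where "\<tau> m = (if m = 0 then 1 else q powr (2 * \<theta> m))" for m
  have \<tau>: "q\<^sup>2 \<le> \<tau> m" "\<tau> m \<le> 1" for m
  proof -
    have "q powr 2 \<le> q powr (2 * \<theta> m)" "q powr (2 * \<theta> m) \<le> q powr 0" if "m \<noteq> 0"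
      by (rule powr_mono'; use \<theta>[of m] that q in simp)+
    then show "q\<^sup>2 \<le> \<tau> m" "\<tau> m \<le> 1" using q q2 by (auto simp: \<tau>_def)
  qed
  have m\<tau>: "(\<lambda>m. real m * (1 - \<tau> m)) \<longlonglongrightarrow> 0"
  proof (rule tendsto_sandwich)
    show "\<forall>\<^sub>F m in sequentially. 0 \<le> real m * (1 - \<tau> m)" using \<tau>(2) by simp
    show "\<forall>\<^sub>F m in sequentially. real m * (1 - \<tau> m) \<le> - 2 * ln q * (real m * \<theta> m)"
    proof (intro always_eventually allI)
      fix m
      have "1 + 2 * \<theta> m * ln q \<le> \<tau> m" if "m \<noteq> 0"
        using that q exp_ge_add_one_self[of "2 * \<theta> m * ln q"] by (simp add: \<tau>_def powr_def mult_ac)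
      then show "real m * (1 - \<tau> m) \<le> - 2 * ln q * (real m * \<theta> m)"
        using mult_left_mono[of "1 - \<tau> m" "- (2 * \<theta> m * ln q)" "real m"] 
        by (cases "m = 0") (auto simp: mult_ac)
    qed
    show "(\<lambda>m. - 2 * ln q * (real m * \<theta> m)) \<longlonglongrightarrow> 0"
      using tendsto_mult[OF tendsto_const assms(5), of "- 2 * ln q"] by simp
  qed simp
  from theta_eventually_positive[OF q d \<tau> m\<tau> pos] eventually_gt_at_top[of 0]
  show ?thesis
  proof eventually_elim
    case (elim m)
    show ?case
    proof (intro exI[of _ "(-1) ^ m"] conjI ballI)
      fix z assume z: "z \<in> {q powr (- real m + \<theta> m) <..< q powr (- real m)}"
      then have z0: "0 < z" by (auto intro: le_less_trans[OF powr_ge_zero])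
      define t where "t = z\<^sup>2 * q ^ (2 * m)"
      have sq: "(q powr y)\<^sup>2 = q powr (2 * y)" for y
        using q by (simp add: power2_eq_square flip: powr_add)
      have qm: "q ^ (2 * m) = q powr (2 * real m)"
        using q powr_realpow[of q "2 * m"] by simp
      have "(q powr (- real m + \<theta> m))\<^sup>2 \<le> z\<^sup>2" "z\<^sup>2 \<le> (q powr (- real m))\<^sup>2"
        using z z0 by (intro power_mono; simp)+
      then have "q powr (2 * (- real m + \<theta> m)) * q powr (2 * real m) \<le> t"
          "t \<le> q powr (2 * - real m) * q powr (2 * real m)"
        unfolding sq t_def qm by (auto intro: mult_right_mono)
      then have "t \<in> {\<tau> m..1}"
        using elim(2) q by (simp add: \<tau>_def flip: powr_add)
      then have S: "0 < (-1) ^ m * (\<Sum>n. (-1) ^ n * d n * q ^ (n * (n + 1)) * (z\<^sup>2) ^ n)"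
        using elim(1) q by (fastforce simp: t_def)
      have "deriv (hahn_exton q \<nu>) z
          = z powr (\<nu> - 1) * (A / P) * (\<Sum>n. (-1) ^ n * d n * q ^ (n * (n + 1)) * (z\<^sup>2) ^ n)"
        using DERIV_imp_deriv[OF DERIV_hahn_exton[OF q z0 c[unfolded c_def[abs_def] a_def]]]
        unfolding A_def P_def d_def c_def a_def .
      then show "sgn (deriv (hahn_exton q \<nu>) z) = (-1) ^ m"
        using S z0 AP by (cases "even m") (auto simp: sgn_mult zero_less_mult_iff)
    qed simp
  qed
qed

end
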